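(* Let $n,k$ be integers with $2\leq k\leq n/2$. The $q$-Kneser graph $K_2(n,k)$ with $q=2$, whose vertices are the $k$-dimensional subspaces of $\mathbb{F}_2^n$ with two vertices adjacent if and only if their intersection is the zero subspace, is not determined by its spectrum; that is, there exists a graph that is cospectral with $K_2(n,k)$ but not isomorphic to it.
   Context: $\mathbb{F}_2$ denotes the field with two elements. All graphs are simple and loopless. The spectrum of a graph is the multiset of eigenvalues of its adjacency matrix. Two graphs are cospectral if they have the same spectrum. A graph is determined by its spectrum if every graph cospectral with it is isomorphic to it. *)

theory Defs
  imports
    "HOL-Library.Z2"
    "HOL-Analysis.Cartesian_Space"
    "Jordan_Normal_Form.Char_Poly"
    "Graph_Theory.Digraph_Isomorphism"
    "Graph_Theory.Pair_Digraph"
begin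

text \<open>
  A finite simple graph is a \<^term>\<open>pair_graph G\<close>: a finite vertex set with a symmetric
  irreflexive arc relation, every edge being represented by its two orientations.
\<close>

text \<open>
  The vertices are listed in an arbitrary order \<open>xs\<close>. By the lemma \<open>graph_spectrum_eq\<close>
  below the spectrum does not depend on this order.
\<close>

definition adjacency_matrix :: "'v pair_pre_digraph \<Rightarrow> 'v list \<Rightarrow> complex mat" where
  "adjacency_matrix G xs =
     mat (length xs) (length xs) (\<lambda>(i, j). if (xs ! i, xs ! j) \<in> parcs G then 1 else 0)"

text \<open>
  Eigenvalues are counted with algebraic multiplicity and taken in the complex numbers, so that
  none is lost by definition; for the symmetric matrices at hand they are all real and the
  algebraic and geometric multiplicities agree.
\<close>

definition graph_spectrum :: "'v pair_pre_digraph \<Rightarrow> complex multiset" where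
  "graph_spectrum G =
     proots (char_poly (adjacency_matrix G (SOME xs. distinct xs \<and> set xs = pverts G)))"

definition cospectral :: "'v pair_pre_digraph \<Rightarrow> 'w pair_pre_digraph \<Rightarrow> bool" where
  "cospectral G H \<longleftrightarrow> graph_spectrum G = graph_spectrum H"

text \<open>
  HOL cannot quantify over the vertex type of \<open>H\<close>. Since \<open>H\<close> is finite, vertices taken from the
  natural numbers cover all cases, see the lemma \<open>determined_by_spectrumD\<close> below.
\<close>

definition determined_by_spectrum :: "'v pair_pre_digraph \<Rightarrow> bool" where
  "determined_by_spectrum G \<longleftrightarrow>
     (\<forall>H :: nat pair_pre_digraph. pair_graph H \<longrightarrow> cospectral H G \<longrightarrow>
        digraph_iso (with_proj H) (with_proj G))"

text \<open>
  The graph \<open>K\<^sub>q(n,k)\<close>, where \<open>q\<close> is the order of the field \<^typ>\<open>'a\<close> and \<open>n\<close> is the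
  cardinality of the index type \<^typ>\<open>'n\<close>.
\<close>

definition q_kneser_graph :: "nat \<Rightarrow> ('a::field ^ 'n) set pair_pre_digraph" where
  "q_kneser_graph k =
     (let V = {S. vec.subspace S \<and> vec.dim S = k}
      in \<lparr> pverts = V, parcs = {(S, T). S \<in> V \<and> T \<in> V \<and> S \<inter> T = {0}} \<rparr>)"


subsection \<open>Well-definedness\<close>

lemma finite_UNIV_bit: "finite (UNIV :: bit set)"
proof -
  have "(UNIV :: bit set) = {0, 1}"
    using bit_not_zero_iff by auto
  then show ?thesis by (metis finite.simps)
qed

lemma finite_UNIV_bit_vec: "finite (UNIV :: (bit ^ 'n) set)"
proof -
  have "finite (UNIV :: ('n \<Rightarrow> bit) set)"
    using finite_PiE[of "UNIV :: 'n set" "\<lambda>_. UNIV :: bit set"] finite_UNIV_bit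
    by (simp add: PiE_UNIV_domain)
  then have "finite (range (vec_lambda :: ('n \<Rightarrow> bit) \<Rightarrow> bit ^ 'n))"
    by (rule finite_imageI)
  moreover have "range (vec_lambda :: ('n \<Rightarrow> bit) \<Rightarrow> bit ^ 'n) = UNIV"
    by (metis surjI vec_nth_inverse)
  ultimately show ?thesis by simp
qed

lemma pair_graphI:
  assumes "finite (pverts G)" "parcs G \<subseteq> pverts G \<times> pverts G"
    and "\<And>u v. (u, v) \<in> parcs G \<Longrightarrow> (v, u) \<in> parcs G"
    and "\<And>u. (u, u) \<notin> parcs G"
  shows "pair_graph G"
proof
  show "finite (parcs G)"
    using assms(1,2) by (meson finite_SigmaI finite_subset)
  show "symmetric (with_proj G)"
    unfolding symmetric_def with_proj_simps sym_def using assms(3) by blast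
  fix e assume e: "e \<in> parcs G"
  show "fst e \<in> pverts G" "snd e \<in> pverts G" using e assms(2) by auto
  show "fst e \<noteq> snd e" using e assms(4) by (metis prod.collapse)
qed (rule assms(1))

lemma pair_graph_q_kneser_graph:
  assumes "k \<ge> 1"
  shows "pair_graph (q_kneser_graph k :: (bit ^ 'n) set pair_pre_digraph)"
proof (rule pair_graphI)
  let ?G = "q_kneser_graph k :: (bit ^ 'n) set pair_pre_digraph"
  have "finite (UNIV :: (bit ^ 'n) set set)"
    using finite_UNIV_bit_vec by (simp add: Finite_Set.finite_set)
  then show "finite (pverts ?G)" by (rule rev_finite_subset) simp
  show "parcs ?G \<subseteq> pverts ?G \<times> pverts ?G"
    by (auto simp: q_kneser_graph_def Let_def)
  show "(v, u) \<in> parcs ?G" if "(u, v) \<in> parcs ?G" for u v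
    using that by (auto simp: q_kneser_graph_def Let_def)
  show "(u, u) \<notin> parcs ?G" for u
  proof
    assume "(u, u) \<in> parcs ?G"
    then have "vec.dim ({0} :: (bit ^ 'n) set) = k"
      by (auto simp: q_kneser_graph_def Let_def)
    with assms show False by simp
  qed
qed

lemma similar_adjacency_matrix:
  assumes "distinct xs" "distinct ys" "set ys = f ` set xs" "inj_on f (set xs)"
    and "\<And>u v. u \<in> set xs \<Longrightarrow> v \<in> set xs \<Longrightarrow> (f u, f v) \<in> parcs H \<longleftrightarrow> (u, v) \<in> parcs G"
  shows "char_poly (adjacency_matrix G xs) = char_poly (adjacency_matrix H ys)"
proof -
  define n where "n = length xs"
  have len: "length ys = n"
    using assms(1-4) by (metis card_image distinct_card n_def)
  define zs where "zs = map f xs"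
  have zs: "distinct zs" "set zs = set ys" "length zs = n"
    using assms by (auto simp: zs_def distinct_map n_def)
  have A: "adjacency_matrix G xs = adjacency_matrix H zs"
    using assms(5) by (auto simp: adjacency_matrix_def zs_def intro!: eq_matI)
  define P where "P as bs = mat n n (\<lambda>(i, j). if as ! i = (bs ! j :: 'b) then 1 else (0 :: complex))"
    for as bs
  have *: "(\<Sum>j<n. if as ! i = bs ! j then g (bs ! j) else (0::complex)) = g (as ! i)"
    if "distinct bs" "set as = set bs" "length as = n" "length bs = n" "i < n" for as bs :: "'b list" and g i
  proof -
    have "as ! i \<in> set bs" using that by (metis nth_mem)
    then have "(\<Sum>x\<in>set bs. if as ! i = x then g x else 0) = g (as ! i)"
      by simp
    moreover have "(\<Sum>x\<in>set bs. if as ! i = x then g x else 0)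
        = (\<Sum>j<n. if as ! i = bs ! j then g (bs ! j) else 0)"
      using that by (intro sum.reindex_bij_betw[symmetric] bij_betw_nth) auto
    ultimately show ?thesis by simp
  qed
  have PP: "P as bs * P bs as = 1\<^sub>m n"
    if "distinct as" "distinct bs" "set as = set bs" "length as = n" "length bs = n" for as bs
  proof (rule eq_matI)
    fix i l assume "i < dim_row (1\<^sub>m n :: complex mat)" "l < dim_col (1\<^sub>m n :: complex mat)"
    then have il: "i < n" "l < n" by auto
    have "(P as bs * P bs as) $$ (i, l)
        = (\<Sum>j<n. (if as ! i = bs ! j then 1 else 0) * (if bs ! j = as ! l then 1 else 0))"
      using il by (simp add: P_def scalar_prod_def lessThan_atLeast0)
    also have "\<dots> = (\<Sum>j<n. if as ! i = bs ! j then (if bs ! j = as ! l then 1 else 0) else 0)"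
      by (rule sum.cong) auto
    also have "\<dots> = (if as ! i = as ! l then 1 else 0)"
      using that il by (intro *) auto
    also have "\<dots> = 1\<^sub>m n $$ (i, l)"
      using il that by (simp add: nth_eq_iff_index_eq)
    finally show "(P as bs * P bs as) $$ (i, l) = 1\<^sub>m n $$ (i, l)" .
  qed (auto simp: P_def)
  let ?a = "\<lambda>u v. if (u, v) \<in> parcs H then 1 else (0 :: complex)"
  let ?M = "mat n n (\<lambda>(i, j). ?a (zs ! i) (ys ! j))"
  have 1: "P zs ys * adjacency_matrix H ys = ?M"
  proof (rule eq_matI)
    fix i l assume "i < dim_row ?M" "l < dim_col ?M"
    then have il: "i < n" "l < n" by auto
    have "(P zs ys * adjacency_matrix H ys) $$ (i, l)
        = (\<Sum>j<n. (if zs ! i = ys ! j then 1 else 0) * ?a (ys ! j) (ys ! l))"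
      using il len by (simp add: P_def adjacency_matrix_def scalar_prod_def lessThan_atLeast0)
    also have "\<dots> = (\<Sum>j<n. if zs ! i = ys ! j then ?a (ys ! j) (ys ! l) else 0)"
      by (rule sum.cong) auto
    also have "\<dots> = ?a (zs ! i) (ys ! l)"
      using zs len assms(2) il by (intro *) auto
    finally show "(P zs ys * adjacency_matrix H ys) $$ (i, l) = ?M $$ (i, l)"
      using il by simp
  qed (auto simp: P_def adjacency_matrix_def len)
  have 2: "?M * P ys zs = adjacency_matrix H zs"
  proof (rule eq_matI)
    fix i l
    assume "i < dim_row (adjacency_matrix H zs)" "l < dim_col (adjacency_matrix H zs)"
    then have il: "i < n" "l < n" by (auto simp: adjacency_matrix_def zs)
    have "(?M * P ys zs) $$ (i, l)
        = (\<Sum>j<n. ?a (zs ! i) (ys ! j) * (if ys ! j = zs ! l then 1 else 0))"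
      using il by (simp add: P_def scalar_prod_def lessThan_atLeast0)
    also have "\<dots> = (\<Sum>j<n. if zs ! l = ys ! j then ?a (zs ! i) (ys ! j) else 0)"
      by (rule sum.cong) auto
    also have "\<dots> = ?a (zs ! i) (zs ! l)"
      using zs len assms(2) il by (intro *) auto
    finally show "(?M * P ys zs) $$ (i, l) = adjacency_matrix H zs $$ (i, l)"
      using il zs by (simp add: adjacency_matrix_def)
  qed (auto simp: P_def adjacency_matrix_def zs)
  have car: "{adjacency_matrix H zs, adjacency_matrix H ys, P zs ys, P ys zs} \<subseteq> carrier_mat n n"
    using zs len by (simp add: adjacency_matrix_def P_def)
  have "P zs ys * P ys zs = 1\<^sub>m n" "P ys zs * P zs ys = 1\<^sub>m n"
    using zs len assms(2) by (simp_all add: PP)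
  with car have "similar_mat (adjacency_matrix H zs) (adjacency_matrix H ys)"
    by (rule similar_matI) (simp add: 1 2)
  then show ?thesis using A char_poly_similar by metis
qed

lemma graph_spectrum_eq:
  assumes "distinct xs" "set xs = pverts G"
  shows "graph_spectrum G = proots (char_poly (adjacency_matrix G xs))"
proof -
  let ?ys = "SOME xs. distinct xs \<and> set xs = pverts G"
  have "distinct ?ys \<and> set ?ys = pverts G"
    using assms by (intro someI[of "\<lambda>xs. distinct xs \<and> set xs = pverts G" xs]) auto
  then show ?thesis
    unfolding graph_spectrum_def using assms
    by (subst similar_adjacency_matrix[of ?ys xs id G G]) auto
qed

lemma determined_by_spectrumD:
  fixes G :: "'v pair_pre_digraph" and H :: "'w pair_pre_digraph"
  assumes "determined_by_spectrum G" "pair_graph H" "cospectral H G"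
  shows "digraph_iso (with_proj H) (with_proj G)"
proof -
  interpret H: pair_graph H by fact
  obtain f :: "'w \<Rightarrow> nat" where f: "inj_on f (pverts H)"
    using H.pair_finite_verts finite_imp_inj_to_nat_seg by metis
  define K where "K = \<lparr> pverts = f ` pverts H, parcs = map_prod f f ` parcs H \<rparr>"
  have arcs: "(f u, f v) \<in> parcs K \<longleftrightarrow> (u, v) \<in> parcs H"
    if "u \<in> pverts H" "v \<in> pverts H" for u v
  proof
    assume "(f u, f v) \<in> parcs K"
    then obtain x y where xy: "(x, y) \<in> parcs H" "f x = f u" "f y = f v"
      by (auto simp: K_def)
    moreover have "x \<in> pverts H" "y \<in> pverts H"
      using xy(1) by (rule H.in_arcsD1, rule H.in_arcsD2)
    ultimately have "x = u" "y = v"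
      using that by (blast intro: inj_onD[OF f])+
    with xy(1) show "(u, v) \<in> parcs H" by simp
  qed (force simp: K_def)
  have K: "pair_graph K"
  proof (rule pair_graphI)
    show "finite (pverts K)" using H.pair_finite_verts by (simp add: K_def)
    show "parcs K \<subseteq> pverts K \<times> pverts K"
      using H.wellformed' by (auto simp: K_def)
    have "sym (parcs H)"
      using H.pair_sym_arcs by (simp add: symmetric_def)
    then show "(v, u) \<in> parcs K" if "(u, v) \<in> parcs K" for u v
      using that by (auto simp: K_def dest: symD)
    show "(u, u) \<notin> parcs K" for u
    proof
      assume "(u, u) \<in> parcs K"
      then obtain x y where xy: "(x, y) \<in> parcs H" "f x = u" "f y = u"
        by (auto simp: K_def)
      then have "x = y" using f H.wellformed' by (metis inj_onD)
      with xy(1) show False using H.pair_no_loops by fastforce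
    qed
  qed
  obtain xs where xs: "distinct xs" "set xs = pverts H"
    using H.pair_finite_verts finite_distinct_list by metis
  have ys: "distinct (map f xs)" "set (map f xs) = pverts K"
    using xs f by (auto simp: distinct_map K_def)
  have "graph_spectrum H = proots (char_poly (adjacency_matrix H xs))"
    using xs by (rule graph_spectrum_eq)
  also have "char_poly (adjacency_matrix H xs) = char_poly (adjacency_matrix K (map f xs))"
    using xs f arcs ys(1) by (intro similar_adjacency_matrix[where f = f]) simp_all
  also have "proots \<dots> = graph_spectrum K"
    using ys by (rule graph_spectrum_eq[symmetric])
  finally have "graph_spectrum H = graph_spectrum K" .
  then have "digraph_iso (with_proj K) (with_proj G)"
    using assms(1,3) K by (simp add: determined_by_spectrum_def cospectral_def)
  moreover have "digraph_iso (with_proj H) (with_proj K)"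
  proof -
    let ?h = "\<lparr> iso_verts = f, iso_arcs = map_prod f f, iso_head = snd, iso_tail = fst \<rparr>"
    have "inj_on (map_prod f f) (parcs H)"
      using f H.wellformed' by (auto simp: inj_on_def)
    then have "pre_digraph.digraph_isomorphism (with_proj H) ?h"
      using f H.wf_digraph_axioms by (simp add: pre_digraph.digraph_isomorphism_def)
    moreover have "with_proj K = app_iso ?h (with_proj H)"
      by (simp add: app_iso_def K_def with_proj_def)
    ultimately show ?thesis unfolding digraph_iso_def by blast
  qed
  ultimately show ?thesis by (rule digraph_iso_trans[rotated])
qed

end

theory Submission
  imports Defs
begin

text \<open>
  Fix subspaces \<open>U \<subseteq> W\<close> of dimensions \<open>k - 2\<close> and \<open>k + 1\<close> and a vector \<open>e \<in> W - U\<close>, and let \<open>C\<close> be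
  the set of the four \<open>k\<close>-spaces between \<open>U\<close> and \<open>W\<close> that avoid \<open>e\<close>: in the Fano plane \<open>W / U\<close> these
  are the lines off a point. They are pairwise non-adjacent. A \<open>k\<close>-space outside \<open>C\<close> is adjacent to
  none of them, except if it meets \<open>W\<close> in at most one nonzero vector \<open>w \<notin> U\<close>; then it is adjacent
  to two of them if \<open>w \<notin> U + \<langle>e\<rangle>\<close>, and to all four otherwise. Hence Godsil-McKay switching with
  respect to \<open>C\<close> preserves the spectrum.

  The two graphs differ in the following respect. In the Kneser graph the three \<open>k\<close>-spaces \<open>A\<close>, \<open>B\<close>, \<open>B'\<close>
  between a \<open>(k - 1)\<close>-space and a \<open>(k + 1)\<close>-space satisfy \<open>N(B) \<subseteq> N(A) \<union> N(B')\<close> and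
  \<open>N(B') \<subseteq> N(A) \<union> N(B)\<close>, and for any two distinct neighbours \<open>S\<close>, \<open>T\<close> of \<open>A\<close> such a triple can be chosen
  with \<open>B\<close> adjacent to exactly one of \<open>S\<close>, \<open>T\<close>. In the switched graph, if \<open>A \<in> C\<close>, then for distinct \<open>A\<close>, \<open>B\<close>, \<open>B'\<close> these
  inclusions force \<open>B\<close> and \<open>B'\<close> into \<open>W\<close>, so \<open>B\<close> cannot tell apart two spaces \<open>S\<close>, \<open>T\<close> that both
  meet \<open>W\<close> in \<open>{0, e}\<close>.
\<close>

section \<open>Isomorphisms as adjacency-preserving vertex bijections\<close>

lemma digraph_iso_with_projD:
  assumes "digraph_iso (with_proj G) (with_proj H)" "pair_graph G"
  obtains f where "bij_betw f (pverts G) (pverts H)"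
    and "\<And>u v. u \<in> pverts G \<Longrightarrow> v \<in> pverts G \<Longrightarrow> (f u, f v) \<in> parcs H \<longleftrightarrow> (u, v) \<in> parcs G"
proof -
  interpret pair_graph G by fact
  obtain h where h: "pre_digraph.digraph_isomorphism (with_proj G) h"
      and H: "with_proj H = app_iso h (with_proj G)"
    using assms(1) unfolding digraph_iso_def by blast
  let ?f = "iso_verts h"
  have inj: "inj_on ?f (pverts G)"
    and ends: "\<And>a. a \<in> parcs G \<Longrightarrow> ?f (fst a) = iso_tail h (iso_arcs h a) \<and> ?f (snd a) = iso_head h (iso_arcs h a)"
    using h by (auto simp: pre_digraph.digraph_isomorphism_def)
  have H': "pverts H = ?f ` pverts G" "parcs H = iso_arcs h ` parcs G"
    "iso_tail h = fst" "iso_head h = snd"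
    using arg_cong[OF H, of verts] arg_cong[OF H, of arcs] arg_cong[OF H, of tail]
      arg_cong[OF H, of head] by simp_all
  \<comment> \<open>Tails and heads are the two projections on both sides, so the vertex map forces
    the arc map.\<close>
  have "iso_arcs h a = (?f (fst a), ?f (snd a))" if "a \<in> parcs G" for a
    using ends[OF that] H' by (simp add: prod_eq_iff)
  then have parcs: "parcs H = (\<lambda>a. (?f (fst a), ?f (snd a))) ` parcs G"
    using H'(2) by (auto simp: image_iff)
  show ?thesis
  proof
    show "bij_betw ?f (pverts G) (pverts H)"
      using inj H'(1) by (simp add: bij_betw_def)
    show "(?f u, ?f v) \<in> parcs H \<longleftrightarrow> (u, v) \<in> parcs G" if "u \<in> pverts G" "v \<in> pverts G" for u v
    proof
      assume "(?f u, ?f v) \<in> parcs H"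
      then obtain x y where "(x, y) \<in> parcs G" "?f x = ?f u" "?f y = ?f v"
        unfolding parcs by force
      moreover from this have "x \<in> pverts G" "y \<in> pverts G"
        using wellformed' by blast+
      ultimately show "(u, v) \<in> parcs G"
        using inj that by (metis inj_onD)
    qed (force simp: parcs)
  qed
qed


subsection \<open>Godsil-McKay switching\<close>

text \<open>Entries are given by vertices instead of positions, so that matrix products become sums
  over the vertex set.\<close>

definition indexed_mat :: "('v \<Rightarrow> 'v \<Rightarrow> 'a) \<Rightarrow> 'v list \<Rightarrow> 'a mat" where
  "indexed_mat f xs = mat (length xs) (length xs) (\<lambda>(i, j). f (xs ! i) (xs ! j))"

lemma indexed_mat_carrier: "indexed_mat f xs \<in> carrier_mat (length xs) (length xs)"
  by (simp add: indexed_mat_def)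

lemma indexed_mat_cong:
  assumes "\<And>u v. u \<in> set xs \<Longrightarrow> v \<in> set xs \<Longrightarrow> f u v = g u v"
  shows "indexed_mat f xs = indexed_mat g xs"
  using assms by (auto simp: indexed_mat_def intro!: eq_matI)

lemma indexed_mat_mult:
  fixes f g :: "'v \<Rightarrow> 'v \<Rightarrow> 'a :: semiring_1"
  assumes "distinct xs"
  shows "indexed_mat f xs * indexed_mat g xs
    = indexed_mat (\<lambda>u v. \<Sum>w\<in>set xs. f u w * g w v) xs"
proof (rule eq_matI)
  fix i j assume "i < dim_row (indexed_mat (\<lambda>u v. \<Sum>w\<in>set xs. f u w * g w v) xs)"
    "j < dim_col (indexed_mat (\<lambda>u v. \<Sum>w\<in>set xs. f u w * g w v) xs)"
  then have ij: "i < length xs" "j < length xs" by (simp_all add: indexed_mat_def)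
  have "(indexed_mat f xs * indexed_mat g xs) $$ (i, j)
      = (\<Sum>l<length xs. f (xs ! i) (xs ! l) * g (xs ! l) (xs ! j))"
    using ij by (simp add: indexed_mat_def scalar_prod_def lessThan_atLeast0)
  also have "\<dots> = (\<Sum>w\<in>set xs. f (xs ! i) w * g w (xs ! j))"
    using assms by (intro sum.reindex_bij_betw bij_betw_nth) auto
  finally show "(indexed_mat f xs * indexed_mat g xs) $$ (i, j)
      = indexed_mat (\<lambda>u v. \<Sum>w\<in>set xs. f u w * g w v) xs $$ (i, j)"
    using ij by (simp add: indexed_mat_def)
qed (simp_all add: indexed_mat_def)

lemma indexed_mat_one:
  assumes "distinct xs"
  shows "indexed_mat (\<lambda>u v. if u = v then 1 else 0) xs = 1\<^sub>m (length xs)"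
  using assms by (auto simp: indexed_mat_def nth_eq_iff_index_eq intro!: eq_matI)

text \<open>Godsil-McKay switching with a single cell. The equivalence with a negated condition is
  an exclusive or; its two disjuncts keep the relation symmetric.\<close>

definition gm_switch :: "'v set \<Rightarrow> 'v pair_pre_digraph \<Rightarrow> 'v pair_pre_digraph" where
  "gm_switch C G =
     (let half = (\<lambda>v. v \<notin> C \<and> 2 * card {c \<in> C. (v, c) \<in> parcs G} = card C)
      in \<lparr> pverts = pverts G,
           parcs = {(u, v). u \<in> pverts G \<and> v \<in> pverts G \<and>
             ((u, v) \<in> parcs G \<longleftrightarrow> \<not> (u \<in> C \<and> half v \<or> v \<in> C \<and> half u))} \<rparr>)"

lemma pverts_gm_switch [simp]: "pverts (gm_switch C G) = pverts G"
  by (simp add: gm_switch_def Let_def)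

lemma parcs_gm_switch_outside:
  assumes "u \<in> pverts G" "v \<in> pverts G" "u \<notin> C" "v \<notin> C"
  shows "(u, v) \<in> parcs (gm_switch C G) \<longleftrightarrow> (u, v) \<in> parcs G"
  using assms by (simp add: gm_switch_def Let_def)

lemma parcs_gm_switch_half:
  assumes "u \<in> pverts G" "v \<in> pverts G" "u \<notin> C" "v \<in> C"
    and "2 * card {c \<in> C. (u, c) \<in> parcs G} = card C"
  shows "(u, v) \<in> parcs (gm_switch C G) \<longleftrightarrow> (u, v) \<notin> parcs G"
  using assms by (simp add: gm_switch_def Let_def)

lemma parcs_gm_switch_not_half:
  assumes "u \<in> pverts G" "v \<in> pverts G" "u \<notin> C" "v \<in> C"
    and "2 * card {c \<in> C. (u, c) \<in> parcs G} \<noteq> card C"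
  shows "(u, v) \<in> parcs (gm_switch C G) \<longleftrightarrow> (u, v) \<in> parcs G"
  using assms by (simp add: gm_switch_def Let_def)

lemma pair_graph_gm_switch:
  assumes "pair_graph G"
  shows "pair_graph (gm_switch C G)"
proof -
  interpret pair_graph G by fact
  have sym: "(u, v) \<in> parcs G \<longleftrightarrow> (v, u) \<in> parcs G" for u v
    using pair_sym_arcs by (auto simp: symmetric_def dest: symD)
  show ?thesis
  proof (rule pair_graphI)
    show "(v, u) \<in> parcs (gm_switch C G)" if "(u, v) \<in> parcs (gm_switch C G)" for u v
      using that sym[of u v] by (auto simp: gm_switch_def Let_def)
    show "(u, u) \<notin> parcs (gm_switch C G)" for u
      using pair_no_loops[of "(u, u)"] by (auto simp: gm_switch_def Let_def)
  qed (auto simp: gm_switch_def Let_def)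
qed

text \<open>
  On the cell \<open>C\<close> of size \<open>2 * m\<close> the matrix \<open>Q\<close> below is \<open>J / m - I\<close>, elsewhere it is the
  identity. It is a symmetric involution, and conjugation by it maps the adjacency matrix to
  that of the switched graph.
\<close>

lemma cospectral_gm_switch:
  assumes "pair_graph G" "C \<subseteq> pverts G" "card C = 2 * m" "0 < m"
    and coclique: "\<And>u v. u \<in> C \<Longrightarrow> v \<in> C \<Longrightarrow> (u, v) \<notin> parcs G"
    and cell: "\<And>v. v \<in> pverts G \<Longrightarrow> v \<notin> C \<Longrightarrow> card {c \<in> C. (v, c) \<in> parcs G} \<in> {0, m, 2 * m}"
  shows "cospectral (gm_switch C G) G"
proof -
  interpret pair_graph G by fact
  have sym: "(u, v) \<in> parcs G \<longleftrightarrow> (v, u) \<in> parcs G" for u v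
    using pair_sym_arcs by (auto simp: symmetric_def dest: symD)
  obtain xs where xs: "distinct xs" "set xs = pverts G"
    using pair_finite_verts finite_distinct_list by metis
  have finC: "finite C" using assms(3,4) card.infinite by fastforce
  define Q :: "'a \<Rightarrow> 'a \<Rightarrow> complex" where
    "Q u v = (if u = v then if u \<in> C then - 1 else 1 else 0)
        + (if u \<in> C \<and> v \<in> C then 1 / of_nat m else 0)" for u v
  have Qsym: "Q u v = Q v u" for u v by (simp add: Q_def)
  \<comment> \<open>As \<open>C\<close> has \<open>2 * m\<close> elements, dividing by
    \<open>m\<close> gives twice the mean: \<open>Q\<close> reflects a function on \<open>C\<close>
    in its mean and fixes it elsewhere.\<close>
  have Qsum: "(\<Sum>w\<in>set xs. Q u w * g w)
      = (if u \<in> C then (\<Sum>w\<in>C. g w) / of_nat m - g u else g u)"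
    if "u \<in> set xs" for g u
  proof -
    have "(\<Sum>w\<in>set xs. Q u w * g w)
        = (\<Sum>w\<in>set xs. if u = w then (if u \<in> C then - g u else g u) else 0)
          + (\<Sum>w\<in>set xs. if w \<in> C then (if u \<in> C then g w / of_nat m else 0) else 0)"
      unfolding sum.distrib[symmetric] by (rule sum.cong) (auto simp: Q_def algebra_simps)
    also have "(\<Sum>w\<in>set xs. if w \<in> C then (if u \<in> C then g w / of_nat m else 0) else 0)
        = (\<Sum>w\<in>C. if u \<in> C then g w / of_nat m else 0)"
      using sum.inter_restrict[of "set xs" "\<lambda>w. if u \<in> C then g w / of_nat m else 0" C]
        assms(2) xs by (simp add: Int_absorb1)
    finally show ?thesis
      using that by (simp add: sum_divide_distrib)
  qed
  define a where "a u v = (if (u, v) \<in> parcs G then 1 else 0 :: complex)" for u v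
  define b where "b u v = (if (u, v) \<in> parcs (gm_switch C G) then 1 else 0 :: complex)" for u v
  have asym: "a u v = a v u" for u v using sym[of u v] by (simp add: a_def)
  have bsym: "b u v = b v u" for u v using sym[of u v] by (auto simp: b_def gm_switch_def Let_def)
  have asum: "(\<Sum>w\<in>C. a v w) = of_nat (card {c \<in> C. (v, c) \<in> parcs G})" for v
    using finC by (simp add: a_def sum.If_cases Int_def)
  have bin: "b u v = a u v" if "u \<in> pverts G" "v \<in> pverts G" "u \<in> C \<longleftrightarrow> v \<in> C" for u v
    using that by (auto simp: a_def b_def gm_switch_def Let_def)
  have aC: "a u v = 0" if "u \<in> C" "v \<in> C" for u v using coclique that by (simp add: a_def)
  \<comment> \<open>Reflection in the mean fixes a constant 0/1 row on \<open>C\<close> and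
    complements a row with exactly \<open>m\<close> ones, which is what switching does.\<close>
  have cross: "(\<Sum>w\<in>C. a v w) / of_nat m - a v u = b v u"
    if "v \<in> pverts G" "v \<notin> C" "u \<in> C" for u v
  proof -
    let ?d = "card {c \<in> C. (v, c) \<in> parcs G}"
    have u: "u \<in> pverts G" using that assms(2) by blast
    have "?d \<in> {0, m, 2 * m}" using that by (intro cell)
    then consider "?d = 0" | "?d = m" | "?d = 2 * m" by auto
    then show ?thesis
    proof cases
      case 1
      then have "{c \<in> C. (v, c) \<in> parcs G} = {}" using finC by simp
      then have "(v, u) \<notin> parcs G" using that(3) by blast
      then show ?thesis
        using 1 that u assms(3,4) unfolding asum by (simp add: a_def b_def gm_switch_def Let_def)
    next
      case 2
      then show ?thesis
        using that u assms(3,4) unfolding asum by (simp add: a_def b_def gm_switch_def Let_def)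
    next
      case 3
      then have "{c \<in> C. (v, c) \<in> parcs G} = C"
        using finC assms(3) by (intro card_subset_eq) auto
      then have "(v, u) \<in> parcs G" using that(3) by blast
      then show ?thesis
        using 3 that u assms(3,4) unfolding asum by (simp add: a_def b_def gm_switch_def Let_def)
    qed
  qed
  let ?Q = "indexed_mat Q xs" and ?A = "indexed_mat a xs" and ?B = "indexed_mat b xs"
  have QQ: "?Q * ?Q = 1\<^sub>m (length xs)"
  proof -
    have "?Q * ?Q = indexed_mat (\<lambda>u v. \<Sum>w\<in>set xs. Q u w * Q w v) xs"
      using xs by (simp add: indexed_mat_mult)
    also have "\<dots> = indexed_mat (\<lambda>u v. if u = v then 1 else 0) xs"
    proof (rule indexed_mat_cong)
      fix u v assume uv: "u \<in> set xs" "v \<in> set xs"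
      \<comment> \<open>For \<open>v\<close> in \<open>C\<close> the sum is 2m/m - 1 = 1; for
        \<open>v\<close> outside \<open>C\<close> all terms vanish.\<close>
      have "(\<Sum>w\<in>C. Q w v) = (if v \<in> C then 1 else 0)"
      proof -
        have "(\<Sum>w\<in>C. Q w v) = (\<Sum>w\<in>C. if w = v then if v \<in> C then - 1 else 1 else 0)
            + (\<Sum>w\<in>C. if v \<in> C then 1 / of_nat m else 0)"
          unfolding sum.distrib[symmetric] by (rule sum.cong) (auto simp: Q_def)
        then show ?thesis using finC assms(3,4) by simp
      qed
      then show "(\<Sum>w\<in>set xs. Q u w * Q w v) = (if u = v then 1 else 0)"
        unfolding Qsum[OF uv(1)] by (auto simp: Q_def)
    qed
    also have "\<dots> = 1\<^sub>m (length xs)" using xs by (simp add: indexed_mat_one)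
    finally show ?thesis .
  qed
  have QA: "?Q * ?A = ?B * ?Q"
  proof -
    have "?Q * ?A = indexed_mat (\<lambda>u v. \<Sum>w\<in>set xs. Q u w * a w v) xs"
      using xs by (simp add: indexed_mat_mult)
    also have "\<dots> = indexed_mat (\<lambda>u v. \<Sum>w\<in>set xs. b u w * Q w v) xs"
    proof (rule indexed_mat_cong)
      fix u v assume uv: "u \<in> set xs" "v \<in> set xs"
      have uv': "u \<in> pverts G" "v \<in> pverts G" using uv xs by auto
      have R: "(\<Sum>w\<in>set xs. b u w * Q w v)
          = (if v \<in> C then (\<Sum>w\<in>C. b u w) / of_nat m - b u v else b u v)"
        using Qsum[OF uv(2), of "b u"] by (simp add: Qsym[of v] mult.commute)
      have L: "(\<Sum>w\<in>set xs. Q u w * a w v)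
          = (if u \<in> C then (\<Sum>w\<in>C. a v w) / of_nat m - a v u else a u v)"
        unfolding Qsum[OF uv(1)] using asym by auto
      have b0: "(\<Sum>w\<in>C. b u w) = 0" if "u \<in> C"
      proof (rule sum.neutral, rule ballI)
        fix w assume "w \<in> C"
        then show "b u w = 0" using that aC[of u w] bin[of u w] assms(2) by auto
      qed
      \<comment> \<open>Reflection in the mean preserves the sum over \<open>C\<close>, so
        reflecting the switched row returns the original one.\<close>
      have bu: "(\<Sum>w\<in>C. b u w) / of_nat m - b u v = a u v" if "u \<notin> C" "v \<in> C"
      proof -
        have "(\<Sum>w\<in>C. b u w) = (\<Sum>w\<in>C. (\<Sum>w\<in>C. a u w) / of_nat m - a u w)"
          using cross uv' that by (intro sum.cong) auto
        also have "\<dots> = (\<Sum>w\<in>C. a u w)"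
          using assms(3,4) by (simp add: sum_subtractf)
        finally show ?thesis using cross[OF uv'(1) that] by (simp add: algebra_simps)
      qed
      show "(\<Sum>w\<in>set xs. Q u w * a w v) = (\<Sum>w\<in>set xs. b u w * Q w v)"
      proof (cases "u \<in> C")
        case u: True
        show ?thesis
        proof (cases "v \<in> C")
          case True
          with u have "(\<Sum>w\<in>C. a v w) = 0" "a v u = 0" "b u v = 0"
            using aC bin[OF uv'] by (simp_all add: sum.neutral)
          then show ?thesis unfolding L R using u True by (simp add: b0)
        next
          case False
          then show ?thesis
            unfolding L R using u cross[OF uv'(2) False u] by (simp add: bsym[of u v])
        qed
      next
        case False
        then show ?thesis unfolding L R using bu bin[OF uv'] by simp
      qed
    qed
    also have "\<dots> = ?B * ?Q" using xs by (simp add: indexed_mat_mult)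
    finally show ?thesis .
  qed
  have car: "{?B, ?A, ?Q, ?Q} \<subseteq> carrier_mat (length xs) (length xs)"
    by (simp add: indexed_mat_carrier)
  have "?B = ?B * (?Q * ?Q)"
    by (simp add: QQ right_mult_one_mat[OF indexed_mat_carrier])
  also have "\<dots> = ?B * ?Q * ?Q"
    using car by (intro assoc_mult_mat[symmetric]) auto
  also have "\<dots> = ?Q * ?A * ?Q" by (simp add: QA)
  finally have "similar_mat ?B ?A"
    by (rule similar_matI[OF car QQ QQ])
  moreover have "?A = adjacency_matrix G xs" "?B = adjacency_matrix (gm_switch C G) xs"
    by (simp_all add: adjacency_matrix_def indexed_mat_def a_def b_def)
  ultimately have "char_poly (adjacency_matrix (gm_switch C G) xs) = char_poly (adjacency_matrix G xs)"
    using char_poly_similar by metis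
  then show ?thesis
    using xs by (simp add: cospectral_def graph_spectrum_eq[of xs])
qed


subsection \<open>Linear algebra over the field with two elements\<close>

lemma bit_add_self [simp]: "x + x = (0 :: bit)"
  by (cases x) simp_all

lemma bit_vec_add_self [simp]: "x + x = (0 :: bit ^ 'n)"
  by (simp add: Finite_Cartesian_Product.vec_eq_iff)

lemma bit_vec_two [simp]: "2 = (0 :: bit ^ 'n)"
  unfolding one_add_one[symmetric] by (rule bit_vec_add_self)

lemma bit_vec_add_cancel [simp]: "x + (x + y) = (y :: bit ^ 'n)" "x + y + y = (x :: bit ^ 'n)"
  by (simp_all only: add.assoc[symmetric] bit_vec_add_self add_0) (simp add: add.assoc)

lemma bit_vec_diff: "x - y = x + (y :: bit ^ 'n)"
  by (simp add: diff_eq_eq)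

lemma bit_vec_add_eq_0_iff: "x + y = 0 \<longleftrightarrow> x = (y :: bit ^ 'n)"
  by (metis bit_vec_add_cancel(2) add_0 bit_vec_add_self)

lemma subspace_bit_iff:
  fixes S :: "(bit ^ 'n) set"
  shows "vec.subspace S \<longleftrightarrow> 0 \<in> S \<and> (\<forall>x\<in>S. \<forall>y\<in>S. x + y \<in> S)"
proof -
  have "c *s x \<in> S" if "0 \<in> S" "x \<in> S" for c x
    using that by (cases c) simp_all
  then show ?thesis by (auto simp: vec.subspace_def)
qed

lemma subspace_bit_add_iff:
  fixes S :: "(bit ^ 'n) set"
  assumes "vec.subspace S" "x \<in> S"
  shows "x + y \<in> S \<longleftrightarrow> y \<in> S" "y + x \<in> S \<longleftrightarrow> y \<in> S"
proof -
  have "y \<in> S" if "x + y \<in> S" for y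
    using vec.subspace_add[OF assms(1,2) that] unfolding bit_vec_add_cancel .
  then show "x + y \<in> S \<longleftrightarrow> y \<in> S"
    using vec.subspace_add[OF assms] by blast
  then show "y + x \<in> S \<longleftrightarrow> y \<in> S"
    by (simp only: add.commute)
qed

lemma ex_bit_iff: "(\<exists>b::bit. P b) \<longleftrightarrow> P 0 \<or> P 1"
proof
  assume "\<exists>b. P b"
  then obtain b where "P b" ..
  then show "P 0 \<or> P 1" by (cases b) simp_all
qed blast

lemma span_insert_bit:
  fixes S :: "(bit ^ 'n) set"
  shows "v \<in> vec.span (insert a S) \<longleftrightarrow> v \<in> vec.span S \<or> v + a \<in> vec.span S"
  by (simp add: vec.span_breakdown_eq ex_bit_iff bit_vec_diff)

lemma span_pair_bit:
  "vec.span {x, y :: bit ^ 'n} = {0, x, y, x + y}"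
proof (rule Set.set_eqI)
  fix v
  have "v + x + y = 0 \<longleftrightarrow> v = x + y"
    unfolding add.assoc by (rule bit_vec_add_eq_0_iff)
  then show "v \<in> vec.span {x, y} \<longleftrightarrow> v \<in> {0, x, y, x + y}"
    unfolding span_insert_bit by (auto simp: bit_vec_add_eq_0_iff simp del: bit_vec_add_cancel)
qed

section \<open>Subspaces avoiding a given subspace or vector\<close>

text \<open>The span of \<open>X\<close> grows by one vector at a time. As long as its dimension is
  below \<open>k\<close>, its sum with \<open>A\<close> is not the whole space, and any vector
  outside this sum can be added without creating an intersection with \<open>A\<close>.\<close>

lemma exists_subspace_avoiding:
  fixes A X :: "(bit ^ 'n) set"
  assumes A: "vec.subspace A" and "vec.dim A + k \<le> CARD('n)"
    and "vec.dim X \<le> k" and "vec.span X \<inter> A = {0}"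
  shows "\<exists>S. vec.subspace S \<and> vec.dim S = k \<and> X \<subseteq> S \<and> S \<inter> A = {0}"
  using assms(3,4)
proof (induction "k - vec.dim X" arbitrary: X)
  case 0
  then show ?case by (intro exI[of _ "vec.span X"]) (auto simp: vec.span_superset)
next
  case (Suc d)
  let ?T = "{x + y |x y. x \<in> vec.span X \<and> y \<in> A}"
  have "vec.dim ?T \<le> vec.dim X + vec.dim A"
    using vec.dim_sums_Int[OF vec.subspace_span[of X] A] by simp
  also have "\<dots> < CARD('n)" using Suc.hyps(2) assms(2) by linarith
  finally have "?T \<noteq> UNIV"
    using vec.dim_UNIV[where ?'a = bit and ?'b = 'n] by (auto simp: card_cart_basis)
  then obtain v where v: "v \<notin> ?T" by blast
  have vX: "v \<notin> vec.span X"
    using v vec.subspace_0[OF A] by force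
  have "vec.span (insert v X) \<inter> A = {0}"
  proof -
    have "w = 0" if "w \<in> A" "w + v \<in> vec.span X" for w
    proof -
      have "v = (w + v) + w" by (simp add: add.commute)
      with v that show ?thesis by blast
    qed
    then show ?thesis
      using Suc.prems(2) vec.subspace_0[OF A] vec.span_zero by (auto simp: span_insert_bit)
  qed
  moreover have "vec.dim (insert v X) = vec.dim X + 1"
    using vX by (simp add: vec.dim_insert)
  ultimately have "\<exists>S. vec.subspace S \<and> vec.dim S = k \<and> insert v X \<subseteq> S \<and> S \<inter> A = {0}"
    using Suc.hyps(2) by (intro Suc.hyps(1)) auto
  then show ?case by blast
qed

text \<open>The span of \<open>x\<close> and \<open>y\<close> is \<open>{0, x, y, x + y}\<close>, so
  it meets \<open>A\<close> trivially and can be enlarged. The test vertices for the switched graph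
  all arise in this way.\<close>

lemma exists_subspace_through_pair:
  fixes A :: "(bit ^ 'n) set"
  assumes "vec.subspace A" "vec.dim A = k" "2 \<le> k" "2 * k \<le> CARD('n)"
    and "x \<notin> A" "y \<notin> A" "x + y \<notin> A"
  obtains S where "vec.subspace S" "vec.dim S = k" "x \<in> S" "y \<in> S" "S \<inter> A = {0}"
proof -
  have "vec.dim {x, y} \<le> card {x, y}"
    by (intro vec.dim_le_card vec.span_superset) simp
  also have "\<dots> \<le> k" using card_insert_le_m1[of 2 "{y}" x] assms(3) by (simp split: if_splits)
  finally have "\<exists>S. vec.subspace S \<and> vec.dim S = k \<and> {x, y} \<subseteq> S \<and> S \<inter> A = {0}"
    using assms vec.subspace_0[OF assms(1)]
    by (intro exists_subspace_avoiding) (auto simp: span_pair_bit)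
  then show ?thesis using that by auto
qed

text \<open>Extend \<open>a\<close> to a basis of \<open>A\<close> and drop it again. With two
  scalars only, the rest of \<open>A\<close> is the single coset of \<open>H\<close> through
  \<open>a\<close>.\<close>

lemma exists_hyperplane_avoiding:
  fixes A :: "(bit ^ 'n) set"
  assumes "vec.subspace A" "a \<in> A" "a \<noteq> 0"
  obtains H where "vec.subspace H" "H \<subseteq> A" "vec.dim A = vec.dim H + 1" "a \<notin> H"
    and "\<And>x. x \<in> A \<Longrightarrow> x \<in> H \<or> x + a \<in> H"
proof -
  obtain B where B: "{a} \<subseteq> B" "B \<subseteq> A" "vec.independent B" "A \<subseteq> vec.span B"
    using vec.maximal_independent_subset_extend[of "{a}" A] assms vec.independent_insert[of a "{}"]
    by auto
  have span: "vec.span B = A" using B assms(1) by (simp add: vec.span_subspace)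
  let ?H = "vec.span (B - {a})"
  have ins: "insert a (B - {a}) = B" using B(1) by auto
  have a: "a \<notin> ?H" using B(1,3) by (auto simp: vec.dependent_def)
  show ?thesis
  proof
    show "?H \<subseteq> A" using span by (metis Diff_subset vec.span_mono)
    show "vec.dim A = vec.dim ?H + 1"
      using vec.dim_insert[of a "B - {a}"] a span ins by (metis vec.dim_span)
    show "x \<in> ?H \<or> x + a \<in> ?H" if "x \<in> A" for x
      using that span ins span_insert_bit[of x a "B - {a}"] by simp
  qed (use a in simp_all)
qed


subsection \<open>A graph invariant\<close>

text \<open>\<open>A\<close>, \<open>B\<close>, \<open>B'\<close> stand for the three
  \<open>k\<close>-spaces of a pencil; the covering conditions are a trace of this that is visible
  in adjacency alone, hence preserved by isomorphisms.\<close>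

definition separating :: "'v pair_pre_digraph \<Rightarrow> bool" where
  "separating G \<longleftrightarrow> (\<forall>A\<in>pverts G. \<forall>S\<in>pverts G. \<forall>T\<in>pverts G.
     S \<noteq> T \<longrightarrow> (S, A) \<in> parcs G \<longrightarrow> (T, A) \<in> parcs G \<longrightarrow>
     (\<exists>B\<in>pverts G. \<exists>B'\<in>pverts G. A \<noteq> B \<and> A \<noteq> B' \<and> B \<noteq> B' \<and>
        (\<forall>R\<in>pverts G. (R, B) \<in> parcs G \<longrightarrow> (R, A) \<in> parcs G \<or> (R, B') \<in> parcs G) \<and>
        (\<forall>R\<in>pverts G. (R, B') \<in> parcs G \<longrightarrow> (R, A) \<in> parcs G \<or> (R, B) \<in> parcs G) \<and>
        ((S, B) \<in> parcs G \<longleftrightarrow> (T, B) \<notin> parcs G)))"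

lemma separatingD:
  assumes "separating G" "A \<in> pverts G" "S \<in> pverts G" "T \<in> pverts G" "S \<noteq> T"
    "(S, A) \<in> parcs G" "(T, A) \<in> parcs G"
  obtains B B' where "B \<in> pverts G" "B' \<in> pverts G" "A \<noteq> B" "A \<noteq> B'" "B \<noteq> B'"
    and "\<And>R. R \<in> pverts G \<Longrightarrow> (R, B) \<in> parcs G \<Longrightarrow> (R, A) \<in> parcs G \<or> (R, B') \<in> parcs G"
    and "\<And>R. R \<in> pverts G \<Longrightarrow> (R, B') \<in> parcs G \<Longrightarrow> (R, A) \<in> parcs G \<or> (R, B) \<in> parcs G"
    and "(S, B) \<in> parcs G \<longleftrightarrow> (T, B) \<notin> parcs G"
proof -
  have "\<exists>B\<in>pverts G. \<exists>B'\<in>pverts G. A \<noteq> B \<and> A \<noteq> B' \<and> B \<noteq> B' \<and>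
        (\<forall>R\<in>pverts G. (R, B) \<in> parcs G \<longrightarrow> (R, A) \<in> parcs G \<or> (R, B') \<in> parcs G) \<and>
        (\<forall>R\<in>pverts G. (R, B') \<in> parcs G \<longrightarrow> (R, A) \<in> parcs G \<or> (R, B) \<in> parcs G) \<and>
        ((S, B) \<in> parcs G \<longleftrightarrow> (T, B) \<notin> parcs G)"
    using assms unfolding separating_def by blast
  then show ?thesis by (elim bexE conjE) (rule that, auto)
qed

lemma separating_iso:
  assumes f: "bij_betw f (pverts G) (pverts H)"
    and arcs: "\<And>u v. u \<in> pverts G \<Longrightarrow> v \<in> pverts G \<Longrightarrow> (f u, f v) \<in> parcs H \<longleftrightarrow> (u, v) \<in> parcs G"
    and "separating H"
  shows "separating G"
  unfolding separating_def
proof (intro ballI impI)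
  have inj: "inj_on f (pverts G)" and img: "pverts H = f ` pverts G"
    using f by (auto simp: bij_betw_def)
  fix A S T assume *: "A \<in> pverts G" "S \<in> pverts G" "T \<in> pverts G" "S \<noteq> T"
    "(S, A) \<in> parcs G" "(T, A) \<in> parcs G"
  then have "f A \<in> pverts H" "f S \<in> pverts H" "f T \<in> pverts H" "f S \<noteq> f T"
    "(f S, f A) \<in> parcs H" "(f T, f A) \<in> parcs H"
    using inj by (auto simp: img arcs inj_on_eq_iff)
  from separatingD[OF assms(3) this]
  obtain C C' where C: "C \<in> pverts H" "C' \<in> pverts H" "f A \<noteq> C" "f A \<noteq> C'" "C \<noteq> C'"
      "\<And>R. R \<in> pverts H \<Longrightarrow> (R, C) \<in> parcs H \<Longrightarrow> (R, f A) \<in> parcs H \<or> (R, C') \<in> parcs H"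
      "\<And>R. R \<in> pverts H \<Longrightarrow> (R, C') \<in> parcs H \<Longrightarrow> (R, f A) \<in> parcs H \<or> (R, C) \<in> parcs H"
      "(f S, C) \<in> parcs H \<longleftrightarrow> (f T, C) \<notin> parcs H"
    by metis
  obtain B B' where B: "B \<in> pverts G" "B' \<in> pverts G" and CB: "C = f B" "C' = f B'"
    using C(1,2) unfolding img by (elim imageE)
  have fR: "f R \<in> pverts H" if "R \<in> pverts G" for R using that unfolding img by (rule imageI)
  show "\<exists>B\<in>pverts G. \<exists>B'\<in>pverts G. A \<noteq> B \<and> A \<noteq> B' \<and> B \<noteq> B' \<and>
        (\<forall>R\<in>pverts G. (R, B) \<in> parcs G \<longrightarrow> (R, A) \<in> parcs G \<or> (R, B') \<in> parcs G) \<and>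
        (\<forall>R\<in>pverts G. (R, B') \<in> parcs G \<longrightarrow> (R, A) \<in> parcs G \<or> (R, B) \<in> parcs G) \<and>
        ((S, B) \<in> parcs G \<longleftrightarrow> (T, B) \<notin> parcs G)"
  proof (rule bexI[OF _ B(1)], rule bexI[OF _ B(2)], intro conjI ballI impI)
    show "A \<noteq> B" "A \<noteq> B'" "B \<noteq> B'" using C(3-5) CB by blast+
    show "(R, A) \<in> parcs G \<or> (R, B') \<in> parcs G" if "R \<in> pverts G" "(R, B) \<in> parcs G" for R
      using C(6)[OF fR[OF that(1)]] that * B by (simp add: CB arcs)
    show "(R, A) \<in> parcs G \<or> (R, B) \<in> parcs G" if "R \<in> pverts G" "(R, B') \<in> parcs G" for R
      using C(7)[OF fR[OF that(1)]] that * B by (simp add: CB arcs)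
    show "(S, B) \<in> parcs G \<longleftrightarrow> (T, B) \<notin> parcs G"
      using C(8) * B by (simp add: CB arcs)
  qed
qed

section \<open>Separation in the Kneser graph\<close>

lemma pverts_q_kneser_graph:
  "S \<in> pverts (q_kneser_graph k) \<longleftrightarrow> vec.subspace S \<and> vec.dim S = k"
  by (simp add: q_kneser_graph_def Let_def)

lemma parcs_q_kneser_graph:
  assumes "S \<in> pverts (q_kneser_graph k)" "T \<in> pverts (q_kneser_graph k)"
  shows "(S, T) \<in> parcs (q_kneser_graph k) \<longleftrightarrow> S \<inter> T = {0}"
  using assms by (simp add: q_kneser_graph_def Let_def)

lemma subspace_Int_nontrivialE:
  assumes "S \<inter> T \<noteq> {0}" "vec.subspace S" "vec.subspace T"
  obtains x where "x \<in> S" "x \<in> T" "x \<noteq> 0"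
proof -
  have "0 \<in> S \<inter> T" using assms(2,3) vec.subspace_0 by (intro IntI)
  then show ?thesis using assms(1) that by blast
qed

text \<open>
  For \<open>x \<in> T - S\<close> the witnesses are \<open>B = H + \<langle>x\<rangle>\<close> and \<open>B' = H + \<langle>x + a\<rangle>\<close>, where \<open>H\<close> is a
  hyperplane of \<open>A\<close> and \<open>a \<in> A - H\<close>. Here \<open>a\<close> is chosen such that \<open>B\<close> misses \<open>S\<close>.
\<close>

lemma separating_q_kneser_graph:
  assumes "1 \<le> k"
  shows "separating (q_kneser_graph k :: (bit ^ 'n) set pair_pre_digraph)"
  unfolding separating_def
proof (intro ballI impI)
  let ?G = "q_kneser_graph k :: (bit ^ 'n) set pair_pre_digraph"
  fix A S T assume V: "A \<in> pverts ?G" "S \<in> pverts ?G" "T \<in> pverts ?G" and "S \<noteq> T"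
    and "(S, A) \<in> parcs ?G" "(T, A) \<in> parcs ?G"
  then have SA: "S \<inter> A = {0}" and TA: "T \<inter> A = {0}" by (simp_all add: parcs_q_kneser_graph)
  have sub: "vec.subspace A" "vec.subspace S" "vec.subspace T"
    and dim: "vec.dim A = k" "vec.dim S = k" "vec.dim T = k"
    using V by (simp_all add: pverts_q_kneser_graph)
  obtain x where x: "x \<in> T" "x \<notin> S"
    using vec.subspace_dim_equal[OF sub(3,2)] dim \<open>S \<noteq> T\<close> by auto
  have xA: "x \<notin> A" using x TA vec.subspace_0[OF sub(2)] by (metis IntI singletonD)
  \<comment> \<open>At most one \<open>y\<close> in \<open>A\<close> has \<open>x + y\<close> in
    \<open>S\<close>, as two of them would differ by an element of \<open>S \<inter> A\<close>.
    Leaving it out of \<open>H\<close> keeps the coset \<open>x + H\<close> away from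
    \<open>S\<close>; if there is none, any nonzero vector serves.\<close>
  obtain a where a: "a \<in> A" "a \<noteq> 0" "\<And>y. y \<in> A \<Longrightarrow> x + y \<in> S \<Longrightarrow> y = a"
  proof (cases "\<exists>y\<in>A. x + y \<in> S")
    case True
    then obtain y where y: "y \<in> A" "x + y \<in> S" by blast
    moreover have "z = y" if "z \<in> A" "x + z \<in> S" for z
    proof -
      have "(x + y) + (x + z) \<in> S" "y + z \<in> A"
        using y that sub by (blast intro: vec.subspace_add)+
      moreover have "(x + y) + (x + z) = y + z" by (simp add: Finite_Cartesian_Product.vec_eq_iff)
      ultimately have "y + z = 0" using SA by force
      then show ?thesis by (simp add: bit_vec_add_eq_0_iff)
    qed
    moreover have "y \<noteq> 0" using y x by auto
    ultimately show ?thesis using that by blast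
  next
    case False
    moreover obtain y where "y \<in> A" "y \<noteq> 0"
      using dim(1) assms vec.dim_eq_0[of A] by fastforce
    ultimately show ?thesis using that by blast
  qed
  obtain H where H: "vec.subspace H" "H \<subseteq> A" "vec.dim A = vec.dim H + 1" "a \<notin> H"
      "\<And>y. y \<in> A \<Longrightarrow> y \<in> H \<or> y + a \<in> H"
    using exists_hyperplane_avoiding[OF sub(1) a(1,2)] by blast
  have spanH: "vec.span H = H" using H(1) by simp
  define B where "B = (\<lambda>y. vec.span (insert y H))"
  have mem: "v \<in> B y \<longleftrightarrow> v \<in> H \<or> v + y \<in> H" for v y
    by (simp add: B_def span_insert_bit spanH)
  have subB: "vec.subspace (B y)" for y by (simp add: B_def)
  have B: "B y \<in> pverts ?G" if "y \<notin> A" for y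
  proof -
    have "y \<notin> vec.span H" unfolding spanH using that H(2) by blast
    then show ?thesis
      using H(3) dim(1) by (simp add: B_def pverts_q_kneser_graph vec.dim_insert)
  qed
  have xaA: "x + a \<notin> A" using xA a(1) sub(1) by (simp add: subspace_bit_add_iff)
  have yB: "y \<in> B y" for y using vec.subspace_0[OF H(1)] by (simp add: mem)
  \<comment> \<open>Contrapositive of a covering condition. Nonzero \<open>u\<close> and
    \<open>v\<close> of \<open>R\<close> in \<open>A\<close> and \<open>B (y + a)\<close> either
    include a member of \<open>H\<close>, or lie in the cosets of \<open>a\<close> and
    \<open>y + a\<close>, and then \<open>u + v\<close> lies in the coset of
    \<open>y\<close>.\<close>
  have cover: "R \<inter> B y \<noteq> {0}"
    if R: "vec.subspace R" "R \<inter> A \<noteq> {0}" "R \<inter> B (y + a) \<noteq> {0}" and y: "y \<notin> A" for R y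
  proof -
    obtain u where u: "u \<in> R" "u \<in> A" "u \<noteq> 0"
      using subspace_Int_nontrivialE[OF R(2,1) sub(1)] .
    obtain v where v: "v \<in> R" "v \<in> B (y + a)" "v \<noteq> 0"
      using subspace_Int_nontrivialE[OF R(3,1) subB] .
    show ?thesis
    proof (cases "u \<in> H \<or> v \<in> H")
      case True
      then have "u \<in> B y \<or> v \<in> B y" unfolding mem by blast
      then show ?thesis using u v by blast
    next
      case False
      then have "u + a \<in> H" "v + (y + a) \<in> H" using H(5) u v by (auto simp: mem)
      then have "(u + a) + (v + (y + a)) \<in> H" using vec.subspace_add[OF H(1)] by blast
      also have "(u + a) + (v + (y + a)) = (u + v) + y + (a + a)" by (simp only: ac_simps)
      finally have uvy: "(u + v) + y \<in> H" by (simp only: bit_vec_add_self add_0_right)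
      then have "u + v \<in> B y" unfolding mem by blast
      moreover have "u + v \<in> R" using u v vec.subspace_add[OF R(1)] by blast
      moreover have "u + v \<noteq> 0"
      proof
        assume "u + v = 0"
        then have "y \<in> H" using uvy by (simp only: add_0)
        then show False using y H(2) by blast
      qed
      ultimately show ?thesis by blast
    qed
  qed
  have 1: "A \<noteq> B x" "A \<noteq> B (x + a)" using yB xA xaA by metis+
  have 2: "B x \<noteq> B (x + a)"
  proof -
    have "x \<notin> B (x + a)" using xA H(2,4) by (auto simp: mem)
    then show ?thesis using yB by metis
  qed
  have 3: "(R, B x) \<in> parcs ?G \<Longrightarrow> (R, A) \<in> parcs ?G \<or> (R, B (x + a)) \<in> parcs ?G"
    if "R \<in> pverts ?G" for R
    using that cover[of R x] V xA B xaA by (auto simp: parcs_q_kneser_graph pverts_q_kneser_graph)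
  \<comment> \<open>The same fact at \<open>x + a\<close>, whose translate by \<open>a\<close> is
    \<open>x\<close> again.\<close>
  have 4: "(R, B (x + a)) \<in> parcs ?G \<Longrightarrow> (R, A) \<in> parcs ?G \<or> (R, B x) \<in> parcs ?G"
    if "R \<in> pverts ?G" for R
    using that cover[of R "x + a"] V xA B xaA
    by (auto simp: parcs_q_kneser_graph pverts_q_kneser_graph)
  have 5: "(S, B x) \<in> parcs ?G"
  proof -
    have "v = 0" if "v \<in> S" "v \<in> B x" for v
    proof (cases "v \<in> H")
      case True
      then show ?thesis using that SA H(2) by blast
    next
      case False
      then have h: "v + x \<in> H" using that mem by blast
      have "x + (v + x) \<in> S" using that by (simp add: add.commute)
      then have "v + x = a" using a(3) h H(2) by blast
      then show ?thesis using h H(4) by simp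
    qed
    then have "S \<inter> B x = {0}" using vec.subspace_0[OF sub(2)] by (auto simp: B_def vec.span_zero)
    then show ?thesis using V B xA by (simp add: parcs_q_kneser_graph)
  qed
  have 6: "(T, B x) \<notin> parcs ?G"
  proof
    assume "(T, B x) \<in> parcs ?G"
    then have "T \<inter> B x = {0}" using V B xA by (simp add: parcs_q_kneser_graph)
    then have "x = 0" using x(1) yB[of x] by blast
    then show False using xA vec.subspace_0[OF sub(1)] by simp
  qed
  show "\<exists>B\<in>pverts ?G. \<exists>B'\<in>pverts ?G. A \<noteq> B \<and> A \<noteq> B' \<and> B \<noteq> B' \<and>
        (\<forall>R\<in>pverts ?G. (R, B) \<in> parcs ?G \<longrightarrow> (R, A) \<in> parcs ?G \<or> (R, B') \<in> parcs ?G) \<and>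
        (\<forall>R\<in>pverts ?G. (R, B') \<in> parcs ?G \<longrightarrow> (R, A) \<in> parcs ?G \<or> (R, B) \<in> parcs ?G) \<and>
        ((S, B) \<in> parcs ?G \<longleftrightarrow> (T, B) \<notin> parcs ?G)"
    by (intro bexI[OF _ B[OF xA]] bexI[OF _ B[OF xaA]] conjI ballI impI 1 2 3 4)
      (simp_all add: 5 6)
qed


no_notation vec_index (infixl "$" 100)

subsection \<open>The switching cell\<close>

text \<open>For fixed \<open>y\<close>, \<open>z\<close> the right side is a linear functional of
  (s, t): if nonzero, it takes each value twice. As (s, t) will parametrise the cell, this counts
  the members avoiding a given vector.\<close>

lemma card_bit_functional_neq:
  fixes x y z :: bit
  shows "card {(s, t). x \<noteq> s * y + t * z}
    = (if y \<noteq> 0 \<or> z \<noteq> 0 then 2 else if x = 0 then 0 else 4)"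
proof -
  have U: "(UNIV :: (bit \<times> bit) set) = {(0, 0), (0, 1), (1, 0), (1, 1)}"
  proof (rule Set.set_eqI)
    show "v \<in> UNIV \<longleftrightarrow> v \<in> {(0, 0), (0, 1), (1, 0), (1, 1)}" for v :: "bit \<times> bit"
      by (cases v; cases "fst v"; cases "snd v") simp_all
  qed
  let ?P = "\<lambda>v. x \<noteq> fst v * y + snd v * z"
  have "{(s, t). x \<noteq> s * y + t * z} = {v \<in> UNIV. ?P v}" by auto
  then have "card {(s, t). x \<noteq> s * y + t * z} = sum (\<lambda>_. 1) {v \<in> UNIV. ?P v}"
    by simp
  also have "\<dots> = (\<Sum>v\<in>UNIV. if ?P v then 1 else 0)"
    by (rule sum.inter_filter) (simp add: U)
  finally show ?thesis
    unfolding U by (cases x; cases y; cases z) simp_all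
qed

text \<open>
  In coordinates, \<open>W\<close> is the space of vectors supported on \<open>{p, q, r} \<union> J\<close>, its subspace \<open>U\<close> consists
  of those supported on \<open>J\<close>, and \<open>e\<close> is the unit vector at \<open>p\<close>. The \<open>k\<close>-spaces between \<open>U\<close> and \<open>W\<close>
  avoiding \<open>e\<close> are then the hyperplanes of \<open>W\<close> on which the \<open>p\<close>-coordinate is a linear function of
  the other two.
\<close>

locale switching_cell =
  fixes k :: nat and p q r :: "'n::finite" and J :: "'n set"
  assumes distinct: "p \<noteq> q" "p \<noteq> r" "q \<noteq> r" "p \<notin> J" "q \<notin> J" "r \<notin> J"
    and card_J: "card J + 2 = k" and k_le: "2 * k \<le> CARD('n)"
begin

abbreviation G :: "(bit ^ 'n) set pair_pre_digraph" where "G \<equiv> q_kneser_graph k"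

definition W :: "(bit ^ 'n) set" where
  "W = {v. \<forall>i. i \<notin> insert p (insert q (insert r J)) \<longrightarrow> v $ i = 0}"

definition hyp :: "bit \<Rightarrow> bit \<Rightarrow> (bit ^ 'n) set" where
  "hyp s t = {v \<in> W. v $ p = s * v $ q + t * v $ r}"

definition C :: "(bit ^ 'n) set set" where "C = range (\<lambda>(s, t). hyp s t)"

abbreviation G' :: "(bit ^ 'n) set pair_pre_digraph" where "G' \<equiv> gm_switch C G"

text \<open>Representatives of \<open>W\<close> modulo \<open>U\<close>; the vector \<open>e\<close>
  is \<open>pt 1 0 0\<close>.\<close>

definition pt :: "bit \<Rightarrow> bit \<Rightarrow> bit \<Rightarrow> bit ^ 'n" where
  "pt x y z = (\<chi> i. if i = p then x else if i = q then y else if i = r then z else 0)"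

lemma pt_nth [simp]: "pt x y z $ p = x" "pt x y z $ q = y" "pt x y z $ r = z"
  using distinct by (simp_all add: pt_def)

lemma pt_in_W [simp]: "pt x y z \<in> W"
  by (simp add: pt_def W_def)

lemma pt_in_hyp_iff: "pt x y z \<in> hyp s t \<longleftrightarrow> x = s * y + t * z"
  by (simp add: hyp_def)

lemma k_ge_2: "2 \<le> k"
  using card_J by simp

lemma subspace_W: "vec.subspace W"
  by (auto simp: subspace_bit_iff W_def)

lemma subspace_hyp: "vec.subspace (hyp s t)"
  unfolding subspace_bit_iff
proof (intro conjI ballI)
  fix x y assume x: "x \<in> hyp s t" and y: "y \<in> hyp s t"
  have "(s * x $ q + t * x $ r) + (s * y $ q + t * y $ r)
      = s * (x $ q + y $ q) + t * (x $ r + y $ r)"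
    by (simp only: distrib_left ac_simps)
  then show "x + y \<in> hyp s t"
    using x y vec.subspace_add[OF subspace_W] unfolding hyp_def by simp
qed (simp add: hyp_def W_def)

lemma hyp_subset_W: "hyp s t \<subseteq> W"
  by (auto simp: hyp_def)

lemma W_cases:
  assumes "v \<in> W"
  shows "v \<in> hyp s t \<or> v + pt 1 0 0 \<in> hyp s t"
proof -
  have "v + pt 1 0 0 \<in> W" using assms subspace_W by (simp add: vec.subspace_add)
  then show ?thesis using assms by (cases "v $ p = s * v $ q + t * v $ r") (auto simp: hyp_def)
qed

text \<open>Both vectors outside the hyperplane would lie in its coset through
  \<open>pt 1 0 0\<close>, and two elements of one coset sum to an element of the
  hyperplane.\<close>

lemma hyp_meets_line:
  assumes "u \<in> W" "v \<in> W"
  shows "u \<in> hyp s t \<or> v \<in> hyp s t \<or> u + v \<in> hyp s t"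
proof (rule ccontr)
  assume *: "\<not> ?thesis"
  then have "u + pt 1 0 0 \<in> hyp s t" "v + pt 1 0 0 \<in> hyp s t"
    using W_cases assms by blast+
  then have "(u + pt 1 0 0) + (v + pt 1 0 0) \<in> hyp s t"
    by (rule vec.subspace_add[OF subspace_hyp])
  also have "(u + pt 1 0 0) + (v + pt 1 0 0) = u + v + (pt 1 0 0 + pt 1 0 0)"
    by (simp only: ac_simps)
  finally show False using * by simp
qed

lemma dim_W: "vec.dim W = k + 1"
  unfolding W_def dim_substandard_cart using distinct card_J
  by simp

lemma dim_hyp: "vec.dim (hyp s t) = k"
proof -
  have span: "vec.span (hyp s t) = hyp s t" using subspace_hyp by simp
  have "vec.span (insert (pt 1 0 0) (hyp s t)) = W"
  proof (rule vec.span_subspace)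
    show "insert (pt 1 0 0) (hyp s t) \<subseteq> W" using hyp_subset_W by simp
    show "W \<subseteq> vec.span (insert (pt 1 0 0) (hyp s t))"
      using W_cases unfolding span_insert_bit span subset_iff by blast
  qed (rule subspace_W)
  then have "vec.dim W = vec.dim (insert (pt 1 0 0) (hyp s t))" by (metis vec.dim_span)
  moreover have "pt 1 0 0 \<notin> vec.span (hyp s t)" unfolding span by (simp add: pt_in_hyp_iff)
  ultimately show ?thesis using dim_W by (simp add: vec.dim_insert)
qed

lemma hyp_in_pverts: "hyp s t \<in> pverts G"
  by (simp add: pverts_q_kneser_graph subspace_hyp dim_hyp)

lemma hyp_in_C: "hyp s t \<in> C"
  by (auto simp: C_def)

lemma CE:
  assumes "A \<in> C" obtains s t where "A = hyp s t"
  using assms by (auto simp: C_def)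

lemma C_subset_pverts: "C \<subseteq> pverts G"
  using hyp_in_pverts by (auto elim!: CE)

lemma hyp_eq_iff: "hyp s t = hyp s' t' \<longleftrightarrow> s = s' \<and> t = t'"
proof
  assume "hyp s t = hyp s' t'"
  moreover have "pt s 1 0 \<in> hyp s t" "pt t 0 1 \<in> hyp s t" by (simp_all add: pt_in_hyp_iff)
  ultimately have "pt s 1 0 \<in> hyp s' t'" "pt t 0 1 \<in> hyp s' t'" by simp_all
  then show "s = s' \<and> t = t'" by (simp add: pt_in_hyp_iff)
qed simp

lemma inj_hyp: "inj_on (\<lambda>(s, t). hyp s t) X"
  by (auto simp: inj_on_def hyp_eq_iff)

lemma card_C: "card C = 4"
proof -
  \<comment> \<open>The condition reads 1 \<noteq> 0, so all four pairs are counted.\<close>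
  have "card C = card {(s :: bit, t). 1 \<noteq> s * 0 + t * (0 :: bit)}"
    unfolding C_def using card_image[OF inj_hyp, of UNIV] by (simp add: case_prod_beta')
  then show ?thesis unfolding card_bit_functional_neq by simp
qed

lemma coclique_C: "(A, B) \<notin> parcs G" if "A \<in> C" "B \<in> C"
proof -
  obtain s t s' t' where AB: "A = hyp s t" "B = hyp s' t'" using \<open>A \<in> C\<close> \<open>B \<in> C\<close> by (metis CE)
  \<comment> \<open>A common vector needs (s + s') y + (t + t') z = 0. Over two elements
    \<open>y = t + t'\<close>, \<open>z = s + s'\<close> solves this, and it is nonzero unless the
    hyperplanes coincide.\<close>
  define y z where "y = (if s = s' \<and> t = t' then 1 else t + t')" and "z = s + s'"
  let ?v = "pt (s * y + t * z) y z"
  have "y \<noteq> 0 \<or> z \<noteq> 0" by (cases s; cases s'; cases t; cases t') (simp_all add: y_def z_def)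
  then have "?v \<noteq> 0" using pt_nth(2,3) zero_index by metis
  moreover have "?v \<in> A \<inter> B"
    by (cases s; cases s'; cases t; cases t') (simp_all add: AB pt_in_hyp_iff y_def z_def)
  ultimately have "A \<inter> B \<noteq> {0}" by blast
  then show ?thesis using that C_subset_pverts by (simp add: parcs_q_kneser_graph subset_iff)
qed

text \<open>Holds if \<open>S\<close> is adjacent to half of the cell, see \<open>card_cell_neighbours\<close>.\<close>

definition half :: "(bit ^ 'n) set \<Rightarrow> bool" where
  "half S \<longleftrightarrow> (\<exists>w. S \<inter> W = {0, w} \<and> (w $ q \<noteq> 0 \<or> w $ r \<noteq> 0))"

lemma half_iff:
  assumes "S \<inter> W = {0, w}"
  shows "half S \<longleftrightarrow> w $ q \<noteq> 0 \<or> w $ r \<noteq> 0"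
proof -
  have "w' = w" if "{0, w} = {0, w'}" for w' using that by (metis doubleton_eq_iff)
  then show ?thesis unfolding half_def assms by auto
qed

lemma card_cell_neighbours:
  assumes "vec.subspace S"
  shows "card {c \<in> C. S \<inter> c = {0}} \<in> {0, 2, 4}"
    and "card {c \<in> C. S \<inter> c = {0}} = 2 \<longleftrightarrow> half S"
proof -
  let ?N = "{c \<in> C. S \<inter> c = {0}}"
  have SW: "S \<inter> hyp s t = (S \<inter> W) \<inter> hyp s t" for s t using hyp_subset_W by blast
  have 0: "0 \<in> S \<inter> W" "\<And>s t. 0 \<in> hyp s t"
    using assms subspace_W subspace_hyp vec.subspace_0 by (blast, blast)
  have "card ?N \<in> {0, 2, 4} \<and> (card ?N = 2 \<longleftrightarrow> half S)"
  \<comment> \<open>The pattern includes \<open>w = 0\<close>, where \<open>S\<close> meets no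
    member of the cell. Outside the pattern \<open>S \<inter> W\<close> contains a full line, which
    meets every member.\<close>
  proof (cases "\<exists>w. S \<inter> W = {0, w}")
    case True
    then obtain w where w: "S \<inter> W = {0, w}" by blast
    note half = half_iff[OF w]
    show ?thesis
    proof (cases "w = 0")
      case True
      then have "?N = C" using w SW 0 by (auto simp: C_def)
      then show ?thesis using card_C half True by simp
    next
      case False
      have "w \<in> W" using w by blast
      then have key: "S \<inter> hyp s t = {0} \<longleftrightarrow> w $ p \<noteq> s * w $ q + t * w $ r" for s t
        unfolding SW w using False 0(2)[of s t] by (auto simp: hyp_def)
      have "?N = (\<lambda>(s, t). hyp s t) ` {(s, t). S \<inter> hyp s t = {0}}"
        unfolding C_def by blast
      also have "\<dots> = (\<lambda>(s, t). hyp s t) ` {(s, t). w $ p \<noteq> s * w $ q + t * w $ r}"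
        unfolding key by (rule refl)
      finally have N: "?N = (\<lambda>(s, t). hyp s t) ` {(s, t). w $ p \<noteq> s * w $ q + t * w $ r}" .
      have "card ?N = card {(s, t). w $ p \<noteq> s * w $ q + t * w $ r}"
        unfolding N by (rule card_image[OF inj_hyp])
      then show ?thesis unfolding card_bit_functional_neq half by simp
    qed
  next
    case False
    have "S \<inter> W \<noteq> {0}"
    proof
      assume "S \<inter> W = {0}"
      then have "S \<inter> W = {0, 0}" by simp
      with False show False by blast
    qed
    then obtain u where u: "u \<in> S \<inter> W" "u \<noteq> 0" using 0(1) by blast
    have "S \<inter> W \<noteq> {0, u}" using False by blast
    then obtain v where v: "v \<in> S \<inter> W" "v \<noteq> 0" "v \<noteq> u" using 0(1) u by blast
    have "S \<inter> hyp s t \<noteq> {0}" for s t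
    proof -
      have "u + v \<in> S" using u v assms by (simp add: vec.subspace_add)
      moreover have "u + v \<noteq> 0" using v by (simp add: bit_vec_add_eq_0_iff)
      ultimately show ?thesis using hyp_meets_line[of u v s t] u v by blast
    qed
    then have "?N = {}" by (auto simp: C_def)
    moreover have "\<not> half S" using False by (auto simp: half_def)
    ultimately show ?thesis by (metis card.empty insertI1 zero_neq_numeral)
  qed
  then show "card ?N \<in> {0, 2, 4}" "card ?N = 2 \<longleftrightarrow> half S" by auto
qed

lemma cell_neighbours_eq:
  assumes "S \<in> pverts G"
  shows "{c \<in> C. (S, c) \<in> parcs G} = {c \<in> C. S \<inter> c = {0}}"
proof -
  have "(S, c) \<in> parcs G \<longleftrightarrow> S \<inter> c = {0}" if "c \<in> C" for c
    using that C_subset_pverts by (intro parcs_q_kneser_graph[OF assms]) (rule subsetD)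
  then show ?thesis by blast
qed

lemma parcs_switched_cell:
  assumes "S \<in> pverts G" "S \<notin> C" "A \<in> C"
  shows "(S, A) \<in> parcs G' \<longleftrightarrow> (S \<inter> A = {0} \<longleftrightarrow> \<not> half S)"
proof -
  have A: "A \<in> pverts G" using assms(3) C_subset_pverts by blast
  have S: "vec.subspace S" using assms(1) by (simp add: pverts_q_kneser_graph)
  have half: "half S \<longleftrightarrow> 2 * card {c \<in> C. (S, c) \<in> parcs G} = card C"
    unfolding cell_neighbours_eq[OF assms(1)] card_C card_cell_neighbours(2)[OF S, symmetric] by linarith
  show ?thesis
  proof (cases "half S")
    case True
    then show ?thesis
      unfolding parcs_gm_switch_half[OF assms(1) A assms(2,3) half[THEN iffD1, OF True]]
        parcs_q_kneser_graph[OF assms(1) A] by blast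
  next
    case False
    then have "2 * card {c \<in> C. (S, c) \<in> parcs G} \<noteq> card C" using half by blast
    from parcs_gm_switch_not_half[OF assms(1) A assms(2,3) this] show ?thesis
      unfolding parcs_q_kneser_graph[OF assms(1) A] using False by blast
  qed
qed

lemma parcs_switched_outside:
  assumes "S \<in> pverts G" "T \<in> pverts G" "S \<notin> C" "T \<notin> C"
  shows "(S, T) \<in> parcs G' \<longleftrightarrow> S \<inter> T = {0}"
  using assms by (simp add: parcs_gm_switch_outside parcs_q_kneser_graph)

lemma cospectral_switched: "cospectral G' G"
proof (rule cospectral_gm_switch[where m = 2])
  show "pair_graph G" using k_ge_2 by (intro pair_graph_q_kneser_graph) simp
  show "card {c \<in> C. (S, c) \<in> parcs G} \<in> {0, 2, 2 * 2}" if "S \<in> pverts G" for S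
    using card_cell_neighbours(1)[of S] that by (simp add: cell_neighbours_eq pverts_q_kneser_graph)
qed (use card_C C_subset_pverts coclique_C in auto)

section \<open>The switched graph is not separating\<close>

lemma notin_C: "b \<in> S \<Longrightarrow> b \<notin> W \<Longrightarrow> S \<notin> C"
  using hyp_subset_W by (auto elim!: CE)

text \<open>A second nonzero vector of \<open>S \<inter> W\<close> would lie off the hyperplane like
  \<open>z\<close>, so its sum with \<open>z\<close> would be a nonzero vector of \<open>S\<close>
  in the hyperplane.\<close>

lemma Int_W_eq:
  assumes "vec.subspace S" "S \<inter> hyp s t = {0}" "z \<in> S" "z \<in> W" "z \<noteq> 0"
  shows "S \<inter> W = {0, z}"
proof -
  have "x = z" if "x \<in> S" "x \<in> W" "x \<noteq> 0" for x
  proof -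
    have "x \<notin> hyp s t" "z \<notin> hyp s t" using that assms by blast+
    then have "x + z \<in> hyp s t" using hyp_meets_line that(2) assms(4) by blast
    moreover have "x + z \<in> S" using that assms by (simp add: vec.subspace_add)
    ultimately have "x + z = 0" using assms(2) by blast
    then show ?thesis by (simp add: bit_vec_add_eq_0_iff)
  qed
  moreover have "0 \<in> S" "0 \<in> W"
    using assms(1) subspace_W vec.subspace_0 by (blast, blast)
  ultimately show ?thesis using assms(3,4) by blast
qed

text \<open>If \<open>S\<close> misses \<open>hyp 0 0\<close>, then \<open>S \<inter> W\<close> is
  \<open>{0, z}\<close>, so \<open>S\<close> is half-adjacent to the cell and switching deletes the
  edge. If \<open>S\<close> meets it, then \<open>S\<close> is not half-adjacent and no edge is
  created.\<close>

lemma not_adjacent_hyp_0_0: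
  assumes "S \<in> pverts G" "S \<notin> C" "z \<in> S" "z \<in> W" "z $ p = 1" "z $ q \<noteq> 0 \<or> z $ r \<noteq> 0"
  shows "(S, hyp 0 0) \<notin> parcs G'"
proof -
  have S: "vec.subspace S" using assms(1) by (simp add: pverts_q_kneser_graph)
  have z: "z \<noteq> 0" "z \<notin> hyp 0 0" using assms(5) by (auto simp: hyp_def)
  have "S \<inter> hyp 0 0 = {0} \<longleftrightarrow> half S"
  proof
    assume "S \<inter> hyp 0 0 = {0}"
    from Int_W_eq[OF S this assms(3,4) z(1)] show "half S" using assms(6) by (simp add: half_iff)
  next
    assume "half S"
    then obtain w where "S \<inter> W = {0, w}" by (auto simp: half_def)
    then have "S \<inter> W = {0, z}" using assms(3,4) z(1) by blast
    then have "S \<inter> hyp 0 0 \<subseteq> {0}" using z hyp_subset_W by blast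
    moreover have "0 \<in> S \<inter> hyp 0 0" using vec.subspace_0[OF S] vec.subspace_0[OF subspace_hyp] by simp
    ultimately show "S \<inter> hyp 0 0 = {0}" by blast
  qed
  then show ?thesis using parcs_switched_cell[OF assms(1,2) hyp_in_C] by simp
qed

lemma W_subset_if_star_subset:
  assumes M: "vec.subspace M"
    and star: "\<And>z. z \<in> W \<Longrightarrow> z $ p = 1 \<Longrightarrow> z $ q \<noteq> 0 \<or> z $ r \<noteq> 0 \<Longrightarrow> z \<in> M"
  shows "W \<subseteq> M"
proof
  \<comment> \<open>The three allowed classes sum to \<open>e\<close>. Adding \<open>e\<close> then
    yields the vectors with zero \<open>p\<close>-coordinate, and a shift by \<open>pt 0 1 0\<close>
    yields the rest.\<close>
  have "pt 1 1 0 + (pt 1 0 1 + pt 1 1 1) \<in> M"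
    by (intro vec.subspace_add[OF M] star) simp_all
  also have "pt 1 1 0 + (pt 1 0 1 + pt 1 1 1) = pt 1 0 0"
    by (simp add: pt_def Finite_Cartesian_Product.vec_eq_iff)
  finally have e: "pt 1 0 0 \<in> M" .
  have *: "w \<in> M" if "w \<in> W" "w $ q \<noteq> 0 \<or> w $ r \<noteq> 0" for w
  proof (cases "w $ p = 0")
    case True
    have "w + pt 1 0 0 \<in> M"
      using True that by (intro star vec.subspace_add[OF subspace_W]) simp_all
    then show ?thesis using subspace_bit_add_iff(2)[OF M e] by blast
  next
    case False
    then show ?thesis using star that by simp
  qed
  fix w assume w: "w \<in> W"
  have a: "pt 0 1 0 \<in> M" by (intro *) simp_all
  show "w \<in> M"
  proof (cases "w $ q \<noteq> 0 \<or> w $ r \<noteq> 0")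
    case False
    then have "w + pt 0 1 0 \<in> M"
      using w by (intro * vec.subspace_add[OF subspace_W]) simp_all
    then show ?thesis using subspace_bit_add_iff(2)[OF M a] by blast
  qed (use * w in blast)
qed

lemma adjacent_common_point:
  assumes "S \<in> pverts G" "T \<in> pverts G" "S \<notin> C" "T \<notin> C" "b \<in> S" "b \<in> T" "b \<notin> W"
  shows "(S, T) \<notin> parcs G'"
proof
  assume "(S, T) \<in> parcs G'"
  then have "b = 0" using parcs_switched_outside[OF assms(1-4)] assms(5,6) by blast
  then show False using assms(7) vec.subspace_0[OF subspace_W] by simp
qed

text \<open>If \<open>b\<close> is not in \<open>B'\<close>, any \<open>z\<close> as in
  \<open>not_adjacent_hyp_0_0\<close> lies in the span of \<open>b\<close> and \<open>B'\<close>: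
  otherwise a \<open>k\<close>-space through \<open>z\<close> and \<open>b\<close> missing
  \<open>B'\<close> violates the covering condition. Such \<open>z\<close> generate
  \<open>W\<close>, so a space of dimension at most \<open>k + 1\<close> would contain
  \<open>W\<close> and \<open>b\<close>, which span dimension \<open>k + 2\<close>.\<close>

lemma cover_outside:
  assumes B: "B \<in> pverts G" "B \<notin> C" and B': "B' \<in> pverts G" "B' \<notin> C"
    and cover: "\<And>R. R \<in> pverts G \<Longrightarrow> (R, B') \<in> parcs G' \<Longrightarrow>
      (R, hyp 0 0) \<in> parcs G' \<or> (R, B) \<in> parcs G'"
    and b: "b \<in> B" "b \<notin> W"
  shows "b \<in> B'"
proof (rule ccontr)
  assume bB': "b \<notin> B'"
  have sub: "vec.subspace B'" "vec.dim B' = k" using B'(1) by (simp_all add: pverts_q_kneser_graph)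
  have span: "vec.span B' = B'" using sub by simp
  have "W \<subseteq> vec.span (insert b B')"
  proof (rule W_subset_if_star_subset)
    fix z assume z: "z \<in> W" "z $ p = 1" "z $ q \<noteq> 0 \<or> z $ r \<noteq> 0"
    show "z \<in> vec.span (insert b B')"
    proof (rule ccontr)
      assume "\<not> ?thesis"
      then have "z \<notin> B'" "z + b \<notin> B'" unfolding span_insert_bit span by blast+
      then obtain R where R: "vec.subspace R" "vec.dim R = k" "z \<in> R" "b \<in> R" "R \<inter> B' = {0}"
        using exists_subspace_through_pair[OF sub k_ge_2 k_le _ bB'] by blast
      have RV: "R \<in> pverts G" using R by (simp add: pverts_q_kneser_graph)
      have RC: "R \<notin> C" using R(4) b(2) by (rule notin_C)
      have "(R, B') \<in> parcs G'" using parcs_switched_outside[OF RV B'(1) RC B'(2)] R(5) by simp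
      moreover have "(R, B) \<notin> parcs G'"
        using RV B(1) RC B(2) R(4) b by (rule adjacent_common_point)
      moreover have "(R, hyp 0 0) \<notin> parcs G'"
        using RV RC R(3) z by (rule not_adjacent_hyp_0_0)
      ultimately show False using cover[OF RV] by blast
    qed
  qed simp
  then have "insert b W \<subseteq> vec.span (insert b B')"
    using vec.span_base[of b "insert b B'"] by blast
  then have "vec.dim (insert b W) \<le> vec.dim (insert b B')"
    using vec.dim_subset vec.dim_span by metis
  moreover have "vec.dim (insert b W) = k + 2"
    using b(2) dim_W unfolding vec.dim_insert vec.span_eq_iff[THEN iffD2, OF subspace_W] by simp
  moreover have "vec.dim (insert b B') \<le> k + 1"
    using sub by (simp add: vec.dim_insert)
  ultimately show False by simp
qed

lemma cover_subset_W:
  assumes B: "B \<in> pverts G" and B': "B' \<in> pverts G"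
    and neq: "hyp 0 0 \<noteq> B'" "B \<noteq> B'"
    and cover: "\<And>R. R \<in> pverts G \<Longrightarrow> (R, B) \<in> parcs G' \<Longrightarrow>
      (R, hyp 0 0) \<in> parcs G' \<or> (R, B') \<in> parcs G'"
    and cover': "\<And>R. R \<in> pverts G \<Longrightarrow> (R, B') \<in> parcs G' \<Longrightarrow>
      (R, hyp 0 0) \<in> parcs G' \<or> (R, B) \<in> parcs G'"
  shows "B \<subseteq> W"
proof (rule ccontr)
  assume "\<not> B \<subseteq> W"
  then obtain b where b: "b \<in> B" "b \<notin> W" by blast
  then have BC: "B \<notin> C" by (rule notin_C)
  have sub: "vec.subspace B" "vec.subspace B'" "vec.dim B = k" "vec.dim B' = k"
    using B B' by (simp_all add: pverts_q_kneser_graph)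
  show False
  proof (cases "B' \<in> C")
    case False
    \<comment> \<open>The part of \<open>B\<close> outside \<open>W\<close> generates
      \<open>B\<close>, so it suffices to place that part in \<open>B'\<close>.\<close>
    have sub_BB': "v \<in> B'" if "v \<in> B" "v \<notin> W" for v
      using cover_outside[OF B BC B' False cover' that] .
    have "v \<in> B'" if "v \<in> B" for v
    proof (cases "v \<in> W")
      case True
      have "v + b \<notin> W" using True b(2) subspace_bit_add_iff(1)[OF subspace_W] by blast
      moreover have "v + b \<in> B" using that b(1) sub(1) by (simp add: vec.subspace_add)
      ultimately have "v + b \<in> B'" "b \<in> B'" using sub_BB' b by blast+
      then show ?thesis using subspace_bit_add_iff(2)[OF sub(2)] by blast
    qed (use sub_BB' that in blast)
    then have "B = B'" using vec.subspace_dim_equal[OF sub(1,2)] sub(3,4) by auto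
    then show False using neq(2) by simp
  next
    case True
    then obtain s t where st: "B' = hyp s t" by (rule CE)
    then have "s \<noteq> 0 \<or> t \<noteq> 0" using neq(1) by auto
    then obtain y z where yz: "s * y + t * z = 1" "y \<noteq> 0 \<or> z \<noteq> 0"
      by (metis add_0 add_0_right bit_not_zero_iff mult_1 mult_zero_right mult_1_right one_neq_zero)
    let ?z = "pt 1 y z"
    have zA: "?z \<notin> hyp 0 0" and zB': "?z \<in> B'" using yz by (simp_all add: pt_in_hyp_iff st)
    have bA: "b \<notin> hyp 0 0" using b(2) hyp_subset_W by blast
    have "?z + b \<notin> W" using b(2) subspace_bit_add_iff(1)[OF subspace_W pt_in_W] by blast
    then have zbA: "?z + b \<notin> hyp 0 0" using hyp_subset_W by blast
    obtain R where R: "vec.subspace R" "vec.dim R = k" "?z \<in> R" "b \<in> R" "R \<inter> hyp 0 0 = {0}"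
      using exists_subspace_through_pair[OF subspace_hyp dim_hyp k_ge_2 k_le zA bA zbA] by blast
    have RV: "R \<in> pverts G" using R by (simp add: pverts_q_kneser_graph)
    have RC: "R \<notin> C" using R(4) b(2) by (rule notin_C)
    have z0: "?z \<noteq> 0" using pt_nth(1) zero_index zero_neq_one by metis
    have "R \<inter> W = {0, ?z}" using Int_W_eq[OF R(1,5,3) pt_in_W z0] .
    then have "half R" using yz(2) by (simp add: half_iff)
    moreover have "R \<inter> B' \<noteq> {0}" using R(3) zB' z0 by blast
    ultimately have "(R, B') \<in> parcs G'" using parcs_switched_cell[OF RV RC True] by blast
    moreover have "(R, B) \<notin> parcs G'"
      using RV B RC BC R(4) b by (rule adjacent_common_point)
    moreover have "(R, hyp 0 0) \<notin> parcs G'"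
      using RV RC R(3) pt_in_W by (rule not_adjacent_hyp_0_0) (use yz in simp_all)
    ultimately show False using cover'[OF RV] by blast
  qed
qed

lemma not_separating_switched: "\<not> separating G'"
proof
  let ?A = "hyp 0 0" and ?e = "pt 1 0 0" and ?a = "pt 0 1 0"
  assume sep: "separating G'"
  \<comment> \<open>Since \<open>k\<close> is at least 2, k + 1 < 2k, which is at most the dimension
    of the whole space.\<close>
  have "W \<noteq> UNIV"
    using dim_W k_le k_ge_2 vec.dim_UNIV[where ?'a = bit and ?'b = 'n] by (auto simp: card_cart_basis)
  then obtain x where x: "x \<notin> W" by blast
  have xW: "u + x \<notin> W" if "u \<in> W" for u
    using x that subspace_bit_add_iff(1)[OF subspace_W] by blast
  have xA: "v \<notin> ?A" if "v \<notin> W" for v using that hyp_subset_W by blast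
  have eA: "?e \<notin> ?A" by (simp add: pt_in_hyp_iff)
  have aA: "?a \<in> ?A" by (simp add: pt_in_hyp_iff)
  have eaW: "?e + ?a \<in> W" by (intro vec.subspace_add subspace_W) simp_all
  \<comment> \<open>\<open>S\<close> and \<open>T\<close> share \<open>e\<close> but pass through
    \<open>x\<close> and \<open>?a + x\<close>. Were they equal, they would contain
    \<open>?a\<close>, a nonzero vector of \<open>?A\<close>.\<close>
  obtain S where S: "vec.subspace S" "vec.dim S = k" "?e \<in> S" "x \<in> S" "S \<inter> ?A = {0}"
    using exists_subspace_through_pair[OF subspace_hyp dim_hyp k_ge_2 k_le eA xA[OF x] xA[OF xW]]
      pt_in_W by blast
  have "?e + (?a + x) \<notin> ?A" using xA[OF xW[OF eaW]] unfolding add.assoc .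
  then obtain T where T: "vec.subspace T" "vec.dim T = k" "?e \<in> T" "?a + x \<in> T" "T \<inter> ?A = {0}"
    using exists_subspace_through_pair[OF subspace_hyp dim_hyp k_ge_2 k_le eA xA[OF xW[OF pt_in_W]]]
    by blast
  have "S \<noteq> T"
  proof
    assume "S = T"
    then have "?a \<in> S" using T(4) S(4) subspace_bit_add_iff(2)[OF S(1)] by blast
    then have "?a = 0" using S(5) aA by blast
    then show False using pt_nth(2) zero_index zero_neq_one by metis
  qed
  \<comment> \<open>\<open>X\<close> meets \<open>W\<close> only in 0 and \<open>e\<close>, so it is
    not half-adjacent and switching leaves its edges alone; within \<open>W\<close> only
    \<open>e\<close> decides adjacency.\<close>
  have adj: "(X, B) \<in> parcs G' \<longleftrightarrow> ?e \<notin> B"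
    if X: "vec.subspace X" "vec.dim X = k" "?e \<in> X" "y \<in> X" "y \<notin> W" "X \<inter> ?A = {0}"
      and B: "B \<in> pverts G" "B \<subseteq> W" for X y B
  proof -
    have XV: "X \<in> pverts G" using X by (simp add: pverts_q_kneser_graph)
    have XC: "X \<notin> C" using X(4,5) by (rule notin_C)
    have e0: "?e \<noteq> 0" using pt_nth(1) zero_index zero_neq_one by metis
    have XW: "X \<inter> W = {0, ?e}" using Int_W_eq[OF X(1,6,3) pt_in_W e0] .
    then have "\<not> half X" by (simp add: half_iff)
    then have "(X, B) \<in> parcs G' \<longleftrightarrow> X \<inter> B = {0}"
      using parcs_switched_cell[OF XV XC] parcs_switched_outside[OF XV B(1) XC] by blast
    also have "\<dots> \<longleftrightarrow> ?e \<notin> B"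
    proof -
      have "0 \<in> B" using B(1) vec.subspace_0 by (auto simp: pverts_q_kneser_graph)
      then show ?thesis using XW B(2) e0 by blast
    qed
    finally show ?thesis .
  qed
  have "?a + x \<notin> W" by (intro xW) simp
  note adjS = adj[OF S(1-4) x S(5)] and adjT = adj[OF T(1-4) this T(5)]
  have V: "?A \<in> pverts G'" "S \<in> pverts G'" "T \<in> pverts G'"
    using S T hyp_in_pverts by (simp_all add: pverts_q_kneser_graph)
  have SA: "(S, ?A) \<in> parcs G'" and TA: "(T, ?A) \<in> parcs G'"
    using adjS adjT hyp_in_pverts hyp_subset_W eA by simp_all
  obtain B B' where B: "B \<in> pverts G'" "B' \<in> pverts G'" "?A \<noteq> B" "?A \<noteq> B'" "B \<noteq> B'"
    and cover: "\<And>R. R \<in> pverts G' \<Longrightarrow> (R, B) \<in> parcs G' \<Longrightarrow> (R, ?A) \<in> parcs G' \<or> (R, B') \<in> parcs G'"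
      "\<And>R. R \<in> pverts G' \<Longrightarrow> (R, B') \<in> parcs G' \<Longrightarrow> (R, ?A) \<in> parcs G' \<or> (R, B) \<in> parcs G'"
    and neq: "(S, B) \<in> parcs G' \<longleftrightarrow> (T, B) \<notin> parcs G'"
    by (rule separatingD[OF sep V \<open>S \<noteq> T\<close> SA TA]) blast
  have "B \<subseteq> W"
    using B cover by (intro cover_subset_W[of B B']) simp_all
  then show False using neq adjS adjT B(1) by simp
qed

section \<open>Conclusion from the invariant\<close>

lemma not_determined: "\<not> determined_by_spectrum G"
proof
  assume det: "determined_by_spectrum G"
  have "pair_graph G" using k_ge_2 by (intro pair_graph_q_kneser_graph) simp
  then have pg: "pair_graph G'" by (rule pair_graph_gm_switch)
  obtain f where f: "bij_betw f (pverts G') (pverts G)"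
      "\<And>u v. u \<in> pverts G' \<Longrightarrow> v \<in> pverts G' \<Longrightarrow> (f u, f v) \<in> parcs G \<longleftrightarrow> (u, v) \<in> parcs G'"
    using digraph_iso_with_projD[OF determined_by_spectrumD[OF det pg cospectral_switched] pg] by blast
  have "separating G" using k_ge_2 by (intro separating_q_kneser_graph) simp
  with f have "separating G'" by (rule separating_iso)
  then show False using not_separating_switched by simp
qed

end

theorem theorem6p1:
  fixes n k :: nat
  assumes "CARD('n::finite) = n"
    and "2 \<le> k"
    and "2 * k \<le> n"
  shows "\<not> determined_by_spectrum (q_kneser_graph k :: (bit ^ 'n) set pair_pre_digraph)"
proof -
  \<comment> \<open>Removing three coordinates \<open>p\<close>, \<open>q\<close>, \<open>r\<close>
    from \<open>k + 1\<close> leaves the \<open>k - 2\<close> coordinates of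
    \<open>J\<close>.\<close>
  obtain I :: "'n set" where I: "card I = k + 1"
    using obtain_subset_with_card_n[of "k + 1" "UNIV :: 'n set"] assms by auto
  then have "card I = Suc (Suc (Suc (k - 2)))" using assms(2) by simp
  then obtain p q r J where "I = insert p (insert q (insert r J))"
      "p \<notin> insert q (insert r J)" "q \<notin> insert r J" "r \<notin> J" "card J = k - 2"
    by (auto simp: card_Suc_eq)
  then interpret switching_cell k p q r J
    using assms by unfold_locales auto
  show ?thesis by (rule not_determined)
qed

end
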